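(* Assume GCH. Let $n$ be a natural number and let $F:[\omega_n]^{<\omega}\to\omega$ be any function. Then some finite set $A\in[\omega_n]^{<\omega}$ can be written in at least $T_n=\frac12\sum_{i=1}^n\binom{n+i}{n}\binom{n}{i}$ ways as $A=H_0\cup H_1$ with $H_0\neq H_1$ and $F(H_0)=F(H_1)$.
   Context: $[\omega_n]^{<\omega}$ denotes the set of finite subsets of $\omega_n$. A way of writing $A=H_0\cup H_1$ is counted as an unordered pair $\{H_0,H_1\}$ (the decompositions $(H_0,H_1)$ and $(H_1,H_0)$ are not regarded as distinct). *)

theory Defs
  imports Complex_Main
begin

unbundle cardinal_syntax

text \<open>
  A formula cannot quantify over types, so this is the generalized continuum hypothesis for the
  infinite cardinals \<^term>\<open>\<kappa>\<close> that are realised on the type \<^typ>\<open>'a\<close>, that is, those of size at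
  most \<^term>\<open>|UNIV :: 'a set|\<close>. The power set and \<^term>\<open>cardSuc \<kappa>\<close> live on \<^typ>\<open>'a set\<close>, hence the
  hypothesis also makes sense for the largest such cardinal.
\<close>

definition GCH :: "'a itself \<Rightarrow> bool" where
  "GCH _ \<longleftrightarrow> (\<forall>\<kappa> :: 'a rel. Card_order \<kappa> \<and> infinite (Field \<kappa>) \<longrightarrow>
     |Pow (Field \<kappa>)| =o cardSuc \<kappa>)"

text \<open>
  \<open>is_omega n r\<close>: the well-order \<open>r\<close> is (isomorphic to) the initial ordinal \<open>\<omega>\<^sub>n\<close>, whose set of
  elements is then \<open>Field r\<close>. In the successor case the predecessor cardinal can always be found
  on the same type, so that asking for it there is no restriction.
\<close>

primrec is_omega :: "nat \<Rightarrow> 'a rel \<Rightarrow> bool" where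
  "is_omega 0 r \<longleftrightarrow> Card_order r \<and> r =o natLeq"
| "is_omega (Suc n) r \<longleftrightarrow> Card_order r \<and> (\<exists>s :: 'a rel. is_omega n s \<and> r =o cardSuc s)"

definition T :: "nat \<Rightarrow> real" where
  "T n = 1 / 2 * (\<Sum>i = 1..n. real ((n + i) choose n) * real (n choose i))"

definition mono_decompositions :: "('a set \<Rightarrow> 'b) \<Rightarrow> 'a set \<Rightarrow> 'a set set set" where
  "mono_decompositions F A = {{H0, H1} | H0 H1. A = H0 \<union> H1 \<and> H0 \<noteq> H1 \<and> F H0 = F H1}"

end

theory Submission
  imports Defs
begin

text \<open>
  Suppose \<open>a\<^sub>1, \<dots>, a\<^sub>2\<^sub>n\<close> are distinct and, for every \<open>k\<close>, the value of
  \<open>F({a\<^sub>1, \<dots>, a\<^sub>k} \<union> P)\<close> is the same for all \<open>n\<close>-element sets \<open>P\<close> of later terms. For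
  \<open>1 \<le> i \<le> n\<close> and \<open>k = n - i\<close> there are \<open>n + i\<close> later terms, and they are covered by two
  \<open>n\<close>-element sets in \<open>(n + i choose n) (n choose i)\<close> ordered ways; adding \<open>a\<^sub>1, \<dots>, a\<^sub>k\<close> to both
  sets gives a monochromatic decomposition of \<open>A = {a\<^sub>1, \<dots>, a\<^sub>2\<^sub>n}\<close> into sets of size \<open>2n - i\<close>.

  Such sequences are found by induction on \<open>n\<close>. Under GCH there is a set \<open>M\<close> of size
  \<open>\<omega>\<^sub>n\<close> in \<open>\<omega>\<^sub>n\<^sub>+\<^sub>1\<close> such that whatever any point does over a subset of \<open>M\<close> of size less than
  \<open>\<omega>\<^sub>n\<close> is already done by a point of \<open>M\<close>. Fix a point \<open>z\<close> outside \<open>M\<close> and apply the induction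
  hypothesis to \<open>t \<mapsto> F(t \<union> {z})\<close> on \<open>M\<close>, choosing each term to behave like \<open>z\<close> over the earlier
  ones; then \<open>z\<close> can be traded for the last element of \<open>P\<close>.
\<close>

section \<open>Cardinal bounds for power sets, finite subsets and small subsets\<close>

lemma card_of_Pow_mono:
  assumes "|A| \<le>o |B|"
  shows "|Pow A| \<le>o |Pow B|"
proof -
  obtain f where "inj_on f A" "f ` A \<subseteq> B"
    using assms card_of_ordLeq by metis
  then have "inj_on ((`) f) (Pow A)" "((`) f) ` Pow A \<subseteq> Pow B"
    by (auto simp: inj_on_image_Pow)
  then show ?thesis
    using card_of_ordLeq by blast
qed

text \<open>Sorting by size gives countably many layers, and layer \<open>k + 1\<close> is covered
  by pairs of a point and a member of layer \<open>k\<close>.\<close>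

lemma card_of_Fpow_ordLeq:
  assumes "|A| \<le>o r" "Cinfinite r"
  shows "|Fpow A| \<le>o r"
proof -
  have fixed_size: "|{t. t \<subseteq> A \<and> finite t \<and> card t = k}| \<le>o r" for k
  proof (induction k)
    case 0
    have "{t. t \<subseteq> A \<and> finite t \<and> card t = 0} = {{}}"
      by auto
    moreover have "Field r \<noteq> {}" "Card_order r"
      using assms(2) by (auto simp: cinfinite_def)
    ultimately show ?case
      by (simp add: Card_order_singl_ordLeq)
  next
    case (Suc k)
    let ?S = "{t. t \<subseteq> A \<and> finite t \<and> card t = k}"
    have "{t. t \<subseteq> A \<and> finite t \<and> card t = Suc k} \<subseteq> (\<lambda>(a, t). insert a t) ` (A \<times> ?S)"
    proof
      fix t assume "t \<in> {t. t \<subseteq> A \<and> finite t \<and> card t = Suc k}"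
      then obtain a u where "t = insert a u" "a \<notin> u" "card u = k" "t \<subseteq> A" "finite t"
        by (auto simp: card_Suc_eq)
      then show "t \<in> (\<lambda>(a, t). insert a t) ` (A \<times> ?S)"
        by (intro image_eqI[of _ _ "(a, u)"]) auto
    qed
    then have "|{t. t \<subseteq> A \<and> finite t \<and> card t = Suc k}| \<le>o |A \<times> ?S|"
      using surj_imp_ordLeq by blast
    also have "|A \<times> ?S| \<le>o r"
      using assms Suc by (auto simp: cinfinite_def intro: card_of_Times_ordLeq_infinite_Field)
    finally show ?case .
  qed
  have "Fpow A = (\<Union>k\<in>UNIV. {t. t \<subseteq> A \<and> finite t \<and> card t = k})"
    by (auto simp: Fpow_def)
  moreover have "|UNIV :: nat set| \<le>o r"
    using assms(2) natLeq_ordLeq_cinfinite card_of_nat ordIso_ordLeq_trans by blast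
  ultimately show ?thesis
    using fixed_size assms(2) by (simp add: UNION_Cinfinite_bound)
qed

text \<open>A nonempty subset of size at most \<open>l\<close> is the image of a map from
  \<open>Field l\<close> to \<open>Y\<close>, and there are at most \<open>(2^l)^l = 2^l\<close>
  such maps.\<close>

lemma card_of_small_subsets:
  assumes Y: "|Y| \<le>o |Pow (Field l)|" and l: "Cinfinite l"
  shows "|{B. B \<subseteq> Y \<and> |B| \<le>o l}| \<le>o |Pow (Field l)|"
proof -
  let ?L = "Field l"
  have Pow: "|Pow ?L| =o ctwo ^c l"
    unfolding cexp_def ctwo_def Field_card_of by (rule card_of_Pow_Func)
  have "|Func ?L Y| = |Y| ^c l"
    by (simp add: cexp_def Field_card_of)
  also have "|Y| ^c l \<le>o (ctwo ^c l) ^c l"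
    using Y Pow l ordLeq_ordIso_trans by (blast intro: cexp_mono1)
  also have "(ctwo ^c l) ^c l =o ctwo ^c l"
    using l by (intro cexp_cprod_ordLeq Card_order_ctwo Cinfinite_Cnotzero ordLeq_refl) auto
  also have "ctwo ^c l =o |Pow ?L|"
    using Pow by (rule ordIso_symmetric)
  finally have Func: "|Func ?L Y| \<le>o |Pow ?L|" .
  have inf: "infinite ?L"
    using l by (simp add: cinfinite_def)
  have lL: "l =o |?L|"
    using l card_of_Field_ordIso ordIso_symmetric by blast
  \<comment> \<open>The empty set is listed apart: it is no image of the nonempty
    \<open>?L\<close>.\<close>
  have "{B. B \<subseteq> Y \<and> |B| \<le>o l} \<subseteq> {{}} \<union> (\<lambda>g. g ` ?L) ` Func ?L Y"
  proof
    fix B assume "B \<in> {B. B \<subseteq> Y \<and> |B| \<le>o l}"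
    then have B: "B \<subseteq> Y" "|B| \<le>o |?L|"
      using lL ordLeq_ordIso_trans by auto
    show "B \<in> {{}} \<union> (\<lambda>g. g ` ?L) ` Func ?L Y"
    proof (cases "B = {}")
      case False
      then obtain g where g: "g ` ?L = B"
        using B(2) card_of_ordLeq2 by metis
      \<comment> \<open>Members of \<open>Func\<close> must be \<open>undefined\<close> outside
        their domain, so \<open>g\<close> is cut down to \<open>?L\<close>.\<close>
      define h where "h x = (if x \<in> ?L then g x else undefined)" for x
      have "h ` ?L = B"
        using g by (auto simp: h_def)
      moreover from this have "h \<in> Func ?L Y"
        using B by (auto simp: Func_def h_def)
      ultimately show ?thesis
        by blast
    qed auto
  qed
  then have "|{B. B \<subseteq> Y \<and> |B| \<le>o l}| \<le>o |{{}} \<union> (\<lambda>g. g ` ?L) ` Func ?L Y|"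
    by (rule card_of_mono1)
  also have "|{{}} \<union> (\<lambda>g. g ` ?L) ` Func ?L Y| \<le>o |Pow ?L|"
  proof (rule Un_Cinfinite_bound)
    show "|{{}}| \<le>o |Pow ?L|"
      by (rule card_of_singl_ordLeq) auto
    show "|(\<lambda>g. g ` ?L) ` Func ?L Y| \<le>o |Pow ?L|"
      using card_of_image Func ordLeq_transitive by blast
    show "Cinfinite |Pow ?L|"
      using inf card_of_Card_order by (simp add: cinfinite_def Field_card_of)
  qed
  finally show ?thesis .
qed

section \<open>Closing off along a regular cardinal\<close>

text \<open>Iterate \<open>E\<close> along \<open>s\<close>, each stage collecting \<open>E\<close>
  of all earlier stages. By regularity a set \<open>B\<close> smaller than \<open>s\<close> already
  lies in one stage, and that stage serves as \<open>Y\<close>. Since \<open>E\<close> need not be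
  monotone, the conclusion concerns \<open>E Y\<close> for a superset \<open>Y\<close> of
  \<open>B\<close> and not \<open>E B\<close>.\<close>

lemma closure_under_small_subsets:
  fixes s :: "'k rel" and E :: "'a set \<Rightarrow> 'a set"
  assumes s: "Cinfinite s" "regularCard s"
    and E: "\<And>Y. Y \<subseteq> X \<Longrightarrow> |Y| \<le>o s \<Longrightarrow> E Y \<subseteq> X \<and> |E Y| \<le>o s"
  obtains M where "M \<subseteq> X" "|M| \<le>o s"
    "\<And>B. B \<subseteq> M \<Longrightarrow> |B| <o s \<Longrightarrow> \<exists>Y. B \<subseteq> Y \<and> Y \<subseteq> X \<and> |Y| \<le>o s \<and> E Y \<subseteq> M"
proof -
  have card: "Card_order s" and inf: "infinite (Field s)"
    using s by (auto simp: cinfinite_def)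
  interpret wo_rel s
    using card by (simp add: wo_rel_def card_order_on_well_order_on)
  define H where "H f i = (\<Union>j\<in>underS i. E (f j))" for f :: "'k \<Rightarrow> 'a set" and i
  define f where "f = worec H"
  have "adm_wo H"
    unfolding adm_wo_def H_def by auto
  then have "f = H f"
    unfolding f_def by (rule worec_fixpoint)
  then have f: "f i = (\<Union>j\<in>underS i. E (f j))" for i
    using fun_cong[of f "H f" i] unfolding H_def by blast
  \<comment> \<open>\<open>E\<close> is controlled only on subsets of \<open>X\<close> of size at
    most \<open>s\<close>, so both bounds must be carried through the induction together.\<close>
  have fX: "f i \<subseteq> X \<and> |f i| \<le>o s" for i
  proof (induction i rule: well_order_induct)
    case (1 i)
    then have "\<forall>j\<in>underS i. E (f j) \<subseteq> X \<and> |E (f j)| \<le>o s"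
      using E by (simp add: underS_def)
    moreover have "|underS i| \<le>o s"
    proof (cases "i \<in> Field s")
      case True
      then show ?thesis
        by (rule ordLess_imp_ordLeq[OF card_of_underS[OF card]])
    next
      case False
      then have "underS i = {}"
        by (auto simp: underS_def Field_def)
      then show ?thesis
        using card by (simp add: Card_order_empty)
    qed
    ultimately show ?case
      using s unfolding f[of i] by (auto intro: UNION_Cinfinite_bound)
  qed
  define M where "M = (\<Union>i\<in>Field s. f i)"
  have "relChain s f"
    unfolding relChain_def
  proof (intro allI impI)
    fix i j assume "(i, j) \<in> s"
    then have "underS i \<subseteq> underS j"
      using TRANS ANTISYM by (auto simp: underS_def dest: transD antisymD)
    then show "f i \<subseteq> f j"
      unfolding f[of i] f[of j] by blast
  qed
  show thesis
  proof
    show "M \<subseteq> X"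
      using fX by (auto simp: M_def)
    show "|M| \<le>o s"
      unfolding M_def using s fX card
      by (intro UNION_Cinfinite_bound) (auto intro: ordIso_imp_ordLeq card_of_Field_ordIso)
    fix B assume "B \<subseteq> M" "|B| <o s"
    then obtain i where i: "i \<in> Field s" "B \<subseteq> f i"
      using regularCard_UNION[OF card s(2) \<open>relChain s f\<close>] unfolding M_def by blast
    \<comment> \<open>An infinite cardinal has no last element; any stage \<open>j\<close> after
      \<open>i\<close> contains \<open>E (f i)\<close>.\<close>
    obtain j where "j \<in> Field s" "i \<noteq> j" "(i, j) \<in> s"
      using infinite_Card_order_limit[OF card inf i(1)] by blast
    then have "E (f i) \<subseteq> M"
      using f[of j] by (auto simp: M_def underS_def)
    then show "\<exists>Y. B \<subseteq> Y \<and> Y \<subseteq> X \<and> |Y| \<le>o s \<and> E Y \<subseteq> M"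
      using i fX by blast
  qed
qed

section \<open>Small sets realising all types over their smaller subsets\<close>

text \<open>In the language of model theory, the type of \<open>z\<close> over \<open>B\<close> is
  the map sending a finite \<open>t \<subseteq> B\<close> to \<open>G t z\<close>.\<close>

definition realises :: "('a set \<Rightarrow> 'a \<Rightarrow> 'b) \<Rightarrow> 'a set \<Rightarrow> 'a \<Rightarrow> 'a \<Rightarrow> bool" where
  "realises G B z x \<longleftrightarrow> (\<forall>t \<in> Fpow B. G t x = G t z)"

text \<open>One representative is chosen for each type over each \<open>B\<close> in
  \<open>BB\<close>; this makes at most \<open>s\<close> times \<open>s\<close> points.\<close>

lemma realising_set:
  fixes G :: "'a set \<Rightarrow> 'a \<Rightarrow> 'b"
  assumes s: "Cinfinite s" and BB: "|BB| \<le>o s"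
    and types: "\<And>B. B \<in> BB \<Longrightarrow> |(\<lambda>z. {(t, G t z) | t. t \<in> Fpow B}) ` X| \<le>o s"
  obtains Z where "Z \<subseteq> X" "|Z| \<le>o s" "\<And>B z. B \<in> BB \<Longrightarrow> z \<in> X \<Longrightarrow> \<exists>x\<in>Z. realises G B z x"
proof -
  \<comment> \<open>A type is coded as the graph of its map, so equal codes give equal values for
    every \<open>t\<close>.\<close>
  define tp where "tp B z = {(t, G t z) | t. t \<in> Fpow B}" for B z
  define Z where "Z = (\<Union>B\<in>BB. inv_into X (tp B) ` (tp B ` X))"
  show thesis
  proof
    show "Z \<subseteq> X"
      unfolding Z_def by (auto intro: inv_into_into)
    have "|inv_into X (tp B) ` (tp B ` X)| \<le>o s" if "B \<in> BB" for B
      using card_of_image types[OF that] ordLeq_transitive unfolding tp_def by blast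
    then show "|Z| \<le>o s"
      unfolding Z_def using s BB by (intro UNION_Cinfinite_bound) auto
    fix B z assume B: "B \<in> BB" "z \<in> X"
    define x where "x = inv_into X (tp B) (tp B z)"
    have "x \<in> Z"
      using B by (auto simp: Z_def x_def)
    moreover have "tp B x = tp B z"
      using B by (simp add: x_def f_inv_into_f)
    then have "realises G B z x"
      unfolding realises_def tp_def by blast
    ultimately show "\<exists>x\<in>Z. realises G B z x"
      by blast
  qed
qed

lemma Cinfinite_is_omega: "is_omega n r \<Longrightarrow> Cinfinite r"
proof (induction n arbitrary: r)
  case 0
  then show ?case
    using Cinfinite_cong natLeq_Cinfinite ordIso_symmetric by auto
next
  case (Suc n)
  then show ?case
    using Cinfinite_cong Cinfinite_cardSuc ordIso_symmetric by (metis is_omega.simps(2))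
qed

lemma regularCard_is_omega:
  assumes "is_omega n r"
  shows "regularCard r"
proof (cases n)
  case 0
  then show ?thesis
    using assms regularCard_ordIso regularCard_natLeq natLeq_Cinfinite ordIso_symmetric by auto
next
  case (Suc k)
  then obtain l :: "'a rel" where "is_omega k l" "r =o cardSuc l"
    using assms by auto
  then show ?thesis
    using Cinfinite_is_omega Cinfinite_cardSuc regularCard_cardSuc regularCard_ordIso
      ordIso_symmetric by metis
qed

text \<open>It suffices that \<open>Y\<close> has at most \<open>s\<close> subsets \<open>B\<close>
  smaller than \<open>s\<close>, with at most \<open>s\<close> types over each. For
  \<open>n = 0\<close> the sets \<open>B\<close> are finite and both counts are countable. For a
  successor \<open>s\<close> of \<open>l\<close>, both counts are at most \<open>2^l\<close>, which
  equals \<open>s\<close> by GCH; this is where GCH enters.\<close>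

lemma realising_set_is_omega:
  fixes G :: "'a set \<Rightarrow> 'a \<Rightarrow> nat" and s :: "'a rel"
  assumes gch: "GCH TYPE('a)" and om: "is_omega n s" and Y: "|Y| \<le>o s"
  obtains Z where "Z \<subseteq> X" "|Z| \<le>o s"
    "\<And>B z. B \<subseteq> Y \<Longrightarrow> |B| <o s \<Longrightarrow> z \<in> X \<Longrightarrow> \<exists>x\<in>Z. realises G B z x"
proof -
  have s: "Cinfinite s"
    using om by (rule Cinfinite_is_omega)
  have "|{B. B \<subseteq> Y \<and> |B| <o s}| \<le>o s \<and>
    (\<forall>B. |B| <o s \<longrightarrow> |(\<lambda>z. {(t, G t z) | t. t \<in> Fpow B}) ` X| \<le>o s)"
  proof (cases n)
    case 0
    then have s_nat: "s =o natLeq"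
      using om by simp
    have fin: "finite B \<longleftrightarrow> |B| <o s" for B :: "'a set"
      using s_nat finite_iff_ordLess_natLeq ordLess_ordIso_trans ordIso_symmetric by metis
    have "{B. B \<subseteq> Y \<and> |B| <o s} = Fpow Y"
      unfolding Fpow_def fin by auto
    moreover have "|(\<lambda>z. {(t, G t z) | t. t \<in> Fpow B}) ` X| \<le>o s" if "|B| <o s" for B
    proof -
      have "finite (Fpow B)"
        using that by (auto simp: fin[symmetric] Fpow_Pow_finite)
      \<comment> \<open>Over a finite \<open>B\<close> a type is a finite set of pairs from a
        countable set.\<close>
      then have "(\<lambda>z. {(t, G t z) | t. t \<in> Fpow B}) ` X \<subseteq> Fpow (Fpow B \<times> UNIV)"
        by (auto simp: Fpow_def)
      then have "|(\<lambda>z. {(t, G t z) | t. t \<in> Fpow B}) ` X| \<le>o |Fpow (Fpow B \<times> (UNIV :: nat set))|"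
        by (rule card_of_mono1)
      also have "|Fpow (Fpow B \<times> (UNIV :: nat set))| \<le>o s"
      proof (rule card_of_Fpow_ordLeq[OF _ s])
        have "|Fpow B| \<le>o s"
          using that s by (intro card_of_Fpow_ordLeq ordLess_imp_ordLeq)
        moreover have "|UNIV :: nat set| \<le>o s"
          using card_of_nat s_nat ordIso_symmetric ordIso_transitive ordIso_imp_ordLeq by blast
        ultimately show "|Fpow B \<times> (UNIV :: nat set)| \<le>o s"
          using s by (auto simp: cinfinite_def intro: card_of_Times_ordLeq_infinite_Field)
      qed
      finally show ?thesis .
    qed
    ultimately show ?thesis
      using card_of_Fpow_ordLeq[OF Y s] by simp
  next
    case (Suc k)
    then obtain l :: "'a rel" where l: "is_omega k l" "s =o cardSuc l"
      using om by auto
    then have li: "Cinfinite l"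
      using Cinfinite_is_omega by blast
    then have "|Pow (Field l)| =o cardSuc l"
      using gch by (auto simp: GCH_def cinfinite_def)
    then have Pow_s: "|Pow (Field l)| =o s"
      using l ordIso_symmetric ordIso_transitive by blast
    have small: "|B| <o s \<longleftrightarrow> |B| \<le>o l" for B :: "'a set"
      using l(2) li cardSuc_ordLeq_ordLess[of l "|B|"] card_of_Card_order ordLess_ordIso_trans
        ordIso_symmetric by metis
    have "|Y| \<le>o |Pow (Field l)|"
      using Y Pow_s ordIso_symmetric ordLeq_ordIso_trans by blast
    then have "|{B. B \<subseteq> Y \<and> |B| \<le>o l}| \<le>o |Pow (Field l)|"
      using li by (rule card_of_small_subsets)
    then have "|{B. B \<subseteq> Y \<and> |B| \<le>o l}| \<le>o s"
      using Pow_s ordLeq_ordIso_trans by blast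
    \<comment> \<open>A type over \<open>B\<close> is a subset of
      \<open>Fpow B \<times> UNIV\<close>, a set of size at most \<open>l\<close>.\<close>
    moreover have "|(\<lambda>z. {(t, G t z) | t. t \<in> Fpow B}) ` X| \<le>o s" if "|B| \<le>o l" for B
    proof -
      have "|Fpow B| \<le>o l"
        using that li by (rule card_of_Fpow_ordLeq)
      moreover have "|UNIV :: nat set| \<le>o l"
        using li natLeq_ordLeq_cinfinite card_of_nat ordIso_ordLeq_trans by blast
      ultimately have "|Fpow B \<times> (UNIV :: nat set)| \<le>o l"
        using li by (auto simp: cinfinite_def intro: card_of_Times_ordLeq_infinite_Field)
      then have "|Fpow B \<times> (UNIV :: nat set)| \<le>o |Field l|"
        using li card_of_Field_ordIso ordIso_symmetric ordLeq_ordIso_trans by blast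
      then have Pow_le: "|Pow (Fpow B \<times> (UNIV :: nat set))| \<le>o |Pow (Field l)|"
        by (rule card_of_Pow_mono)
      have sub: "(\<lambda>z. {(t, G t z) | t. t \<in> Fpow B}) ` X \<subseteq> Pow (Fpow B \<times> UNIV)"
        by auto
      show ?thesis
        using ordLeq_ordIso_trans[OF ordLeq_transitive[OF card_of_mono1[OF sub] Pow_le] Pow_s] .
    qed
    ultimately show ?thesis
      unfolding small by simp
  qed
  then show thesis
    using realising_set[OF s, of "{B. B \<subseteq> Y \<and> |B| <o s}" G X thesis] that by simp
qed

text \<open>Let \<open>E Y\<close> realise all types over small subsets of \<open>Y\<close>, and
  close off under \<open>E\<close>. A small \<open>B \<subseteq> M\<close> lies in some
  \<open>Y\<close> with \<open>E Y \<subseteq> M\<close>, so its types are realised inside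
  \<open>M\<close>.\<close>

lemma realising_closed_set:
  fixes G :: "'a set \<Rightarrow> 'a \<Rightarrow> nat" and s :: "'a rel"
  assumes gch: "GCH TYPE('a)" and om: "is_omega n s"
  obtains M where "M \<subseteq> X" "|M| \<le>o s"
    "\<And>B z. B \<subseteq> M \<Longrightarrow> |B| <o s \<Longrightarrow> z \<in> X \<Longrightarrow> \<exists>x\<in>M. realises G B z x"
proof -
  define good where "good Y Z \<longleftrightarrow> Z \<subseteq> X \<and> |Z| \<le>o s \<and>
    (\<forall>B \<subseteq> Y. |B| <o s \<longrightarrow> (\<forall>z\<in>X. \<exists>x\<in>Z. realises G B z x))" for Y Z
  have "\<exists>Z. good Y Z" if "|Y| \<le>o s" for Y
  proof (rule realising_set_is_omega[OF gch om that, of X G])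
    fix Z
    assume "Z \<subseteq> X" "|Z| \<le>o s"
      "\<And>B z. B \<subseteq> Y \<Longrightarrow> |B| <o s \<Longrightarrow> z \<in> X \<Longrightarrow> \<exists>x\<in>Z. realises G B z x"
    then have "good Y Z"
      by (simp add: good_def)
    then show ?thesis ..
  qed
  then obtain E where E: "\<And>Y. |Y| \<le>o s \<Longrightarrow> good Y (E Y)"
    by metis
  have E_le: "E Y \<subseteq> X \<and> |E Y| \<le>o s" if "|Y| \<le>o s" for Y
    using E[OF that] by (simp add: good_def)
  show thesis
  proof (rule closure_under_small_subsets[OF Cinfinite_is_omega[OF om] regularCard_is_omega[OF om] E_le])
    fix M
    assume M: "M \<subseteq> X" "|M| \<le>o s"
      "\<And>B. B \<subseteq> M \<Longrightarrow> |B| <o s \<Longrightarrow> \<exists>Y. B \<subseteq> Y \<and> Y \<subseteq> X \<and> |Y| \<le>o s \<and> E Y \<subseteq> M"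
    have "\<exists>x\<in>M. realises G B z x" if B: "B \<subseteq> M" "|B| <o s" "z \<in> X" for B z
    proof -
      obtain Y where Y: "B \<subseteq> Y" "|Y| \<le>o s" "E Y \<subseteq> M"
        using M(3)[OF B(1,2)] by blast
      then have "\<exists>x\<in>E Y. realises G B z x"
        using E[OF Y(2)] B(2,3) by (simp add: good_def)
      then show ?thesis
        using Y(3) by blast
    qed
    with M(1,2) show thesis
      by (rule that)
  qed
qed

section \<open>End-homogeneous sequences\<close>

text \<open>The member of \<open>P\<close> with the largest index is singled out; it is the term
  that will be traded for \<open>z\<close>.\<close>

lemma split_last_in_list:
  assumes "P \<subseteq> set (drop k xs)" "P \<noteq> {}"
  obtains j where "j < length xs" "k \<le> j" "xs ! j \<in> P"
    "set (take k xs) \<union> (P - {xs ! j}) \<subseteq> set (take j xs)"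
proof -
  define J where "J = {j. j < length xs \<and> k \<le> j \<and> xs ! j \<in> P}"
  have index: "\<exists>j\<in>J. x = xs ! j" if x: "x \<in> P" for x
  proof -
    obtain i where "i < length (drop k xs)" "x = drop k xs ! i"
      using x assms(1) by (metis in_mono in_set_conv_nth)
    then show ?thesis
      using x by (intro bexI[of _ "k + i"]) (auto simp: J_def)
  qed
  then have "J \<noteq> {}" "finite J"
    using assms(2) by (auto simp: J_def)
  then have max: "Max J \<in> J" "\<And>i. i \<in> J \<Longrightarrow> i \<le> Max J"
    by auto
  show thesis
  proof
    show "Max J < length xs" "k \<le> Max J" "xs ! Max J \<in> P"
      using max(1) by (auto simp: J_def)
    have "x \<in> set (take (Max J) xs)" if x: "x \<in> P - {xs ! Max J}" for x
    proof -
      obtain i where i: "i \<in> J" "x = xs ! i"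
        using x index by blast
      then have "i < Max J"
        using x max(2)[of i] by (cases "i = Max J") auto
      then show ?thesis
        using i nth_mem[of i "take (Max J) xs"] by (simp add: J_def)
    qed
    then show "set (take k xs) \<union> (P - {xs ! Max J}) \<subseteq> set (take (Max J) xs)"
      using set_take_subset_set_take[OF \<open>k \<le> Max J\<close>, of xs] by auto
  qed
qed

text \<open>
  The induction needs the relation \<open>R\<close>, which records the demands on a new term made in the
  outer steps.
\<close>

lemma end_homogeneous_list:
  fixes F :: "'a set \<Rightarrow> nat" and r :: "'a rel"
  assumes gch: "GCH TYPE('a)" and "is_omega n r"
    and "\<forall>M \<subseteq> X. |M| <o r \<longrightarrow> (\<exists>z\<in>X. \<forall>t\<in>Fpow M. R t z)"
  shows "\<exists>xs d. length xs = m \<and> set xs \<subseteq> X \<and>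
    (\<forall>j<m. \<forall>t \<subseteq> set (take j xs). R t (xs ! j)) \<and>
    (\<forall>k. \<forall>P \<subseteq> set (drop k xs). card P = n \<longrightarrow> F (set (take k xs) \<union> P) = d k)"
  using assms(2,3)
proof (induction n arbitrary: r X F R)
  case 0
  have fin: "\<exists>z\<in>X. \<forall>t\<in>Fpow M. R t z" if "finite M" "M \<subseteq> X" for M
    using 0 that finite_iff_ordLess_natLeq ordLess_ordIso_trans ordIso_symmetric
    by (metis is_omega.simps(1))
  have "\<exists>xs. length xs = m \<and> set xs \<subseteq> X \<and> (\<forall>j<m. \<forall>t \<subseteq> set (take j xs). R t (xs ! j))"
  proof (induction m)
    case (Suc m)
    then obtain xs where xs: "length xs = m" "set xs \<subseteq> X"
      "\<forall>j<m. \<forall>t \<subseteq> set (take j xs). R t (xs ! j)"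
      by blast
    obtain z where z: "z \<in> X" "\<forall>t\<in>Fpow (set xs). R t z"
      using fin xs(2) by blast
    then have "\<forall>t \<subseteq> set xs. R t z"
      using finite_subset by (auto simp: Fpow_def)
    then show ?case
      using xs z(1) by (intro exI[of _ "xs @ [z]"]) (auto simp: nth_append less_Suc_eq)
  qed simp
  then obtain xs where xs: "length xs = m" "set xs \<subseteq> X"
    "\<forall>j<m. \<forall>t \<subseteq> set (take j xs). R t (xs ! j)"
    by blast
  \<comment> \<open>Here \<open>P\<close> is empty, so for \<open>n = 0\<close> only the demands
    \<open>R\<close> carry content.\<close>
  have "F (set (take k xs) \<union> P) = F (set (take k xs))"
    if "P \<subseteq> set (drop k xs)" "card P = 0" for k P
    using that finite_subset[OF that(1)] by simp
  then show ?case
    using xs by (intro exI[of _ xs] exI[of _ "\<lambda>k. F (set (take k xs))"]) blast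
next
  case (Suc n)
  then obtain s :: "'a rel" where s: "is_omega n s" "r =o cardSuc s"
    by auto
  \<comment> \<open>\<open>R\<close> and \<open>F\<close> are coded in one number, with 0 reserved
    for failure of \<open>R\<close>. A point agreeing with \<open>z\<close> under \<open>G\<close>
    therefore inherits \<open>R\<close> from \<open>z\<close> as well as the value of
    \<open>F\<close>.\<close>
  define G where "G t x = (if R t x then Suc (F (insert x t)) else 0)" for t x
  obtain M where M: "M \<subseteq> X" "|M| \<le>o s"
    "\<And>B z. B \<subseteq> M \<Longrightarrow> |B| <o s \<Longrightarrow> z \<in> X \<Longrightarrow> \<exists>x\<in>M. realises G B z x"
    using realising_closed_set[OF gch s(1), of X G] by blast
  have "s <o r"
    using s Cinfinite_is_omega cardSuc_greater ordIso_symmetric ordLess_ordIso_trans by blast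
  then have "|M| <o r"
    using M(2) ordLeq_ordLess_trans by blast
  then obtain z where z: "z \<in> X" "\<forall>t\<in>Fpow M. R t z"
    using Suc.prems(2) M(1) by blast
  \<comment> \<open>The demands passed inwards: the old ones, and to behave like \<open>z\<close>
    over the earlier terms.\<close>
  define R' where "R' t x \<longleftrightarrow> R t x \<and> F (insert x t) = F (insert z t)" for t x
  have "\<exists>x\<in>M. \<forall>t\<in>Fpow B. R' t x" if B: "B \<subseteq> M" "|B| <o s" for B
  proof -
    obtain x where x: "x \<in> M" "\<forall>t\<in>Fpow B. G t x = G t z"
      using M(3)[OF B z(1)] by (auto simp: realises_def)
    moreover have "\<forall>t\<in>Fpow B. R t z"
      using z(2) B(1) Fpow_mono by blast
    ultimately show ?thesis
      unfolding G_def R'_def by (intro bexI[of _ x]) (auto split: if_splits)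
  qed
  then have "\<forall>B \<subseteq> M. |B| <o s \<longrightarrow> (\<exists>x\<in>M. \<forall>t\<in>Fpow B. R' t x)"
    by blast
  from Suc.IH[OF s(1) this, of "\<lambda>t. F (insert z t)"]
  obtain xs d where xs: "length xs = m" "set xs \<subseteq> M"
    "\<forall>j<m. \<forall>t \<subseteq> set (take j xs). R' t (xs ! j)"
    and "\<forall>k. \<forall>P \<subseteq> set (drop k xs). card P = n \<longrightarrow> F (insert z (set (take k xs) \<union> P)) = d k"
    by (elim exE conjE) (rule that)
  then have d: "F (insert z (set (take k xs) \<union> P)) = d k"
    if "P \<subseteq> set (drop k xs)" "card P = n" for k P
    using that by simp
  have "F (set (take k xs) \<union> P) = d k" if P: "P \<subseteq> set (drop k xs)" "card P = Suc n" for k P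
  proof -
    obtain j where j: "j < length xs" "xs ! j \<in> P"
      "set (take k xs) \<union> (P - {xs ! j}) \<subseteq> set (take j xs)"
      using split_last_in_list[OF P(1)] P(2) by (metis card.empty nat.distinct(1))
    have "F (set (take k xs) \<union> P) = F (insert (xs ! j) (set (take k xs) \<union> (P - {xs ! j})))"
      using j(2) by (intro arg_cong[of _ _ F]) blast
    \<comment> \<open>All other elements precede the term with index \<open>j\<close>, so its demand
      \<open>R'\<close> applies to them.\<close>
    also have "\<dots> = F (insert z (set (take k xs) \<union> (P - {xs ! j})))"
      using j xs(1,3) by (simp add: R'_def)
    also have "\<dots> = d k"
      using P j(2) by (intro d) auto
    finally show ?thesis .
  qed
  then show ?case
    using xs M(1) by (intro exI[of _ xs] exI[of _ d]) (auto simp: R'_def)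
qed

section \<open>Counting covering pairs\<close>

definition covering_pairs :: "nat \<Rightarrow> 'a set \<Rightarrow> ('a set \<times> 'a set) set" where
  "covering_pairs n B = {(P, Q). P \<union> Q = B \<and> card P = n \<and> card Q = n}"

lemma finite_covering_pairs: "finite B \<Longrightarrow> finite (covering_pairs n B)"
  by (rule finite_subset[of _ "Pow B \<times> Pow B"]) (auto simp: covering_pairs_def)

text \<open>After choosing \<open>P\<close>, the set \<open>Q\<close> must contain the
  \<open>i\<close> points of \<open>B - P\<close>, and its other \<open>n - i\<close> points form an
  arbitrary subset \<open>S\<close> of \<open>P\<close>.\<close>

lemma card_covering_pairs:
  assumes B: "finite B" "card B = n + i" and "i \<le> n"
  shows "card (covering_pairs n B) = ((n + i) choose n) * (n choose i)"
proof -
  have eq: "covering_pairs n B = (SIGMA P : {P. P \<subseteq> B \<and> card P = n}.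
      (\<lambda>S. (B - P) \<union> S) ` {S. S \<subseteq> P \<and> card S = n - i})" (is "_ = Sigma ?A ?Q")
  proof (intro set_eqI iffI)
    fix p assume "p \<in> covering_pairs n B"
    then obtain P Q where p: "p = (P, Q)" "P \<union> Q = B" "card P = n" "card Q = n"
      by (auto simp: covering_pairs_def)
    have "finite P" "finite Q"
      using p B by auto
    then have "card (P \<inter> Q) = n - i"
      using card_Un_Int[of P Q] p B by simp
    moreover have "Q = (B - P) \<union> (P \<inter> Q)"
      using p by blast
    ultimately show "p \<in> Sigma ?A ?Q"
      using p by auto
  next
    fix p assume "p \<in> Sigma ?A ?Q"
    then obtain P S where p: "p = (P, (B - P) \<union> S)" "P \<subseteq> B" "card P = n" "S \<subseteq> P" "card S = n - i"
      by auto
    have "finite P"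
      using p(2) B(1) by (rule finite_subset)
    moreover from p(4) this have "finite S"
      by (rule finite_subset)
    ultimately have "card ((B - P) \<union> S) = n"
      using p B \<open>i \<le> n\<close> by (subst card_Un_disjoint) (auto simp: card_Diff_subset)
    then show "p \<in> covering_pairs n B"
      using p by (auto simp: covering_pairs_def)
  qed
  have "card (?Q P) = n choose i" if P: "P \<in> ?A" for P
  proof -
    have "finite P" "card P = n"
      using P B(1) finite_subset[of P B] by auto
    then have "card {S. S \<subseteq> P \<and> card S = n - i} = n choose i"
      using n_subsets[of P "n - i"] \<open>i \<le> n\<close> by (simp add: binomial_symmetric[of i n])
    moreover have "inj_on (\<lambda>S. (B - P) \<union> S) {S. S \<subseteq> P \<and> card S = n - i}"
      by (auto simp: inj_on_def)
    ultimately show ?thesis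
      by (simp add: card_image)
  qed
  moreover have "finite (?Q P)" if "P \<in> ?A" for P
    using that B(1) finite_subset[of P B] by simp
  moreover have "finite ?A"
    using B by simp
  ultimately have "card (Sigma ?A ?Q) = card ?A * (n choose i)"
    by (subst card_SigmaI) auto
  then show ?thesis
    using eq n_subsets[OF B(1), of n] B(2) by simp
qed

text \<open>Every fibre lies in \<open>{(x, y), (y, x)}\<close>. This accounts for the factor 1/2 in
  \<open>T\<close>.\<close>

lemma card_le_twice_unordered:
  assumes "finite S"
  shows "card S \<le> 2 * card ((\<lambda>(x, y). {x, y}) ` S)"
proof -
  let ?f = "\<lambda>(x, y). {x, y}"
  have fibre: "card {p \<in> S. ?f p = u} \<le> 2" if u: "u \<in> ?f ` S" for u
  proof -
    obtain x y where "u = {x, y}"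
      using u by auto
    have "{p \<in> S. ?f p = u} \<subseteq> {(x, y), (y, x)}"
    proof
      fix p assume "p \<in> {p \<in> S. ?f p = u}"
      then have "{fst p, snd p} = {x, y}"
        using \<open>u = {x, y}\<close> by (simp add: case_prod_unfold)
      then show "p \<in> {(x, y), (y, x)}"
        unfolding doubleton_eq_iff by (cases p) simp
    qed
    then have "card {p \<in> S. ?f p = u} \<le> card {(x, y), (y, x)}"
      by (intro card_mono finite.intros)
    then show ?thesis
      \<comment> \<open>The length of a list bounds the size of its set, which also covers the case
        \<open>x = y\<close>.\<close>
      using card_length[of "[(x, y), (y, x)]"] by simp
  qed
  have "(\<Union>u\<in>?f ` S. {p \<in> S. ?f p = u}) = S"
    by blast
  then have "card S \<le> (\<Sum>u\<in>?f ` S. card {p \<in> S. ?f p = u})"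
    using card_UN_le[OF finite_imageI[OF assms, of ?f], of "\<lambda>u. {p \<in> S. ?f p = u}"] by simp
  also have "\<dots> \<le> 2 * card (?f ` S)"
    using sum_bounded_above[of "?f ` S" "\<lambda>u. card {p \<in> S. ?f p = u}" 2, OF fibre] by (simp add: mult.commute)
  finally show ?thesis .
qed

section \<open>From the sequence to the decompositions\<close>

theorem theorem2:
  fixes n :: nat and r :: "'a rel" and F :: "'a set \<Rightarrow> nat"
  assumes "GCH TYPE('a)"
    and "is_omega n r"
  shows "\<exists>A \<in> Fpow (Field r). real (card (mono_decompositions F A)) \<ge> T n"
proof -
  \<comment> \<open>The outermost demand \<open>R t z\<close> is \<open>z \<notin> t\<close>, which
    makes the terms of the sequence distinct.\<close>
  have "\<exists>z\<in>Field r. \<forall>t\<in>Fpow M. z \<notin> t" if M: "M \<subseteq> Field r" "|M| <o r" for M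
  proof -
    have "M \<noteq> Field r"
      using M(2) Cinfinite_is_omega[OF assms(2)] card_of_Field_ordIso[of r]
        not_ordLess_ordIso[of "|Field r|" r] by auto
    then obtain z where "z \<in> Field r" "z \<notin> M"
      using M(1) by blast
    then show ?thesis
      by (auto simp: Fpow_def)
  qed
  then have "\<forall>M \<subseteq> Field r. |M| <o r \<longrightarrow> (\<exists>z\<in>Field r. \<forall>t\<in>Fpow M. z \<notin> t)"
    by blast
  from end_homogeneous_list[OF assms this, where m = "2 * n" and F = F]
  obtain xs d where xs: "length xs = 2 * n" "set xs \<subseteq> Field r"
    and new: "\<forall>j<2 * n. \<forall>t \<subseteq> set (take j xs). xs ! j \<notin> t"
    and "\<forall>k. \<forall>P \<subseteq> set (drop k xs). card P = n \<longrightarrow> F (set (take k xs) \<union> P) = d k"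
    by (elim exE conjE) (rule that)
  then have d: "F (set (take k xs) \<union> P) = d k"
    if "P \<subseteq> set (drop k xs)" "card P = n" for k P
    using that by simp
  have "xs ! i \<noteq> xs ! j" if "i < j" "j < length xs" for i j
    using that new xs(1) nth_mem[of i "take j xs"] by auto
  then have "distinct xs"
    unfolding distinct_conv_nth by (metis linorder_neqE_nat)
  define A where "A = set xs"
  define C where "C i = set (take (n - i) xs)" for i
  define B where "B i = set (drop (n - i) xs)" for i
  have disj: "C i \<inter> B i = {}" for i
    unfolding B_def C_def
    using \<open>distinct xs\<close> by (rule set_take_disj_set_drop_if_distinct) simp
  have A: "C i \<union> B i = A" for i
    unfolding A_def B_def C_def set_append[symmetric] by simp
  have card_C: "card (C i) = n - i" and card_B: "i \<le> n \<Longrightarrow> card (B i) = n + i" for i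
    using \<open>distinct xs\<close> xs(1) by (auto simp: B_def C_def distinct_card)
  \<comment> \<open>The initial segment \<open>C i\<close> is added to both members of a covering
    pair of the tail \<open>B i\<close>.\<close>
  define ext where "ext i = map_prod ((\<union>) (C i)) ((\<union>) (C i))" for i
  define S where "S = (\<Union>i\<in>{1..n}. ext i ` covering_pairs n (B i))"
  have fin: "finite (ext i ` covering_pairs n (B i))" for i
    by (simp add: finite_covering_pairs B_def)
  \<comment> \<open>The sizes \<open>2n - i\<close> tell the families for different \<open>i\<close>
    apart, so their cardinalities add up.\<close>
  have card_fst: "card (fst p) = n - i + n" if p: "p \<in> ext i ` covering_pairs n (B i)" for i p
  proof -
    obtain P Q where PQ: "(P, Q) \<in> covering_pairs n (B i)" "fst p = C i \<union> P"
      using p by (auto simp: ext_def)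
    then have P: "P \<subseteq> B i" "card P = n"
      by (auto simp: covering_pairs_def)
    have "finite P"
      using P(1) by (rule finite_subset) (simp add: B_def)
    moreover have "finite (C i)"
      by (simp add: C_def)
    moreover have "C i \<inter> P = {}"
      using P(1) disj[of i] by blast
    ultimately show ?thesis
      using PQ(2) P(2) card_C[of i] by (simp add: card_Un_disjoint)
  qed
  have "inj_on (ext i) (covering_pairs n (B i))" for i
  proof (rule inj_onI)
    fix p q
    assume p: "p \<in> covering_pairs n (B i)" and q: "q \<in> covering_pairs n (B i)"
      and eq: "ext i p = ext i q"
    have "fst p \<subseteq> B i" "snd p \<subseteq> B i" "fst q \<subseteq> B i" "snd q \<subseteq> B i"
      using p q by (auto simp: covering_pairs_def)
    moreover have "C i \<union> fst p = C i \<union> fst q" "C i \<union> snd p = C i \<union> snd q"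
      using eq by (auto simp: ext_def map_prod_def split: prod.splits)
    ultimately show "p = q"
      using disj[of i] by (intro prod_eqI) blast+
  qed
  then have card_ext: "card (ext i ` covering_pairs n (B i)) = ((n + i) choose n) * (n choose i)"
    if "i \<in> {1..n}" for i
    using that card_B[of i] card_covering_pairs[of "B i" n i] by (simp add: card_image B_def)
  have "ext i ` covering_pairs n (B i) \<inter> ext j ` covering_pairs n (B j) = {}"
    if "i \<in> {1..n}" "j \<in> {1..n}" "i \<noteq> j" for i j
  proof -
    have "n - i + n \<noteq> n - j + n"
      using that by auto
    then show ?thesis
      using card_fst by (metis disjoint_iff)
  qed
  then have "card S = (\<Sum>i\<in>{1..n}. card (ext i ` covering_pairs n (B i)))"
    unfolding S_def using fin by (intro card_UN_disjoint) auto
  then have card_S: "card S = (\<Sum>i = 1..n. ((n + i) choose n) * (n choose i))"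
    using card_ext by simp
  have "finite S"
    unfolding S_def using fin by blast
  have "(\<lambda>(H, K). {H, K}) ` S \<subseteq> mono_decompositions F A"
  proof clarsimp
    fix H K assume "(H, K) \<in> S"
    then obtain i P Q where i: "1 \<le> i" "i \<le> n" and PQ: "P \<union> Q = B i" "card P = n" "card Q = n"
      and HK: "H = C i \<union> P" "K = C i \<union> Q"
      by (auto simp: S_def ext_def covering_pairs_def)
    \<comment> \<open>Equality would give \<open>B i\<close> only \<open>n\<close> elements instead
      of \<open>n + i\<close>; this uses \<open>1 \<le> i\<close>.\<close>
    have "P \<noteq> Q"
      using PQ card_B[of i] i by auto
    then have "H \<noteq> K"
      using HK PQ disj[of i] by blast
    moreover have "P \<subseteq> set (drop (n - i) xs)" "Q \<subseteq> set (drop (n - i) xs)"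
      using PQ(1) by (auto simp: B_def)
    then have "F H = F K"
      using d[of P "n - i"] d[of Q "n - i"] PQ(2,3) HK by (simp add: C_def)
    moreover have "A = H \<union> K"
      using A[of i] PQ HK by auto
    ultimately show "{H, K} \<in> mono_decompositions F A"
      unfolding mono_decompositions_def by blast
  qed
  \<comment> \<open>Finiteness is required for \<open>card\<close> to be monotone, as infinite sets
    have \<open>card\<close> 0.\<close>
  moreover have "finite (mono_decompositions F A)"
    by (rule finite_subset[of _ "Pow (Pow A)"]) (auto simp: mono_decompositions_def A_def)
  ultimately have "card ((\<lambda>(H, K). {H, K}) ` S) \<le> card (mono_decompositions F A)"
    using card_mono by blast
  then have "card S \<le> 2 * card (mono_decompositions F A)"
    using card_le_twice_unordered[OF \<open>finite S\<close>] by linarith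
  then have "real (card S) \<le> 2 * real (card (mono_decompositions F A))"
    by linarith
  moreover have "T n = real (card S) / 2"
    unfolding T_def card_S by simp
  moreover have "A \<in> Fpow (Field r)"
    using xs(2) by (simp add: A_def Fpow_def)
  ultimately show ?thesis
    by (intro bexI[of _ A]) auto
qed

end
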